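(* For every $n\ge 1$ and every generalized Orlicz ball $K\subset\mathbb{R}^n$ of volume $1$ in isotropic position, $$\sigma_K\le\sqrt{5}.$$
   Context: A generalized Orlicz ball in $\mathbb{R}^n$ is a set of the form $K=\{x\in\mathbb{R}^n:\sum_{i=1}^n f_i(|x_i|)\le 1\}$, where $f_1,\dots,f_n:[0,\infty)\to[0,\infty)$ (the Young functions) are convex, (strictly) increasing and satisfy $f_i(0)=0$. $K$ of volume $1$ is in isotropic position if, for $X=(X_1,\dots,X_n)$ uniformly distributed on $K$, $\mathbb{E}X_i=0$ and $\mathbb{E}X_iX_j=L_K^2\delta_{ij}$ for all $i,j$, for some constant $L_K>0$. With $X$ uniformly distributed on $K$ and $|\cdot|$ the Euclidean norm, $\sigma_K\ge 0$ is defined by $$\sigma_K^2=\frac{\operatorname{Var}(|X|^2)}{nL_K^4}=\frac{n\operatorname{Var}(|X|^2)}{(\mathbb{E}|X|^2)^2}.$$ *)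

theory Defs
  imports "HOL-Probability.Probability"
begin

text \<open>A Young function is a map from \<open>[0, \<infinity>)\<close> to itself; its values at negative
  arguments are junk and never used.\<close>

definition young_function :: "(real \<Rightarrow> real) \<Rightarrow> bool" where
  "young_function f \<longleftrightarrow>
     f \<in> {0..} \<rightarrow> {0..} \<and> convex_on {0..} f \<and> strict_mono_on {0..} f \<and> f 0 = 0"

definition orlicz_ball :: "('n::finite \<Rightarrow> real \<Rightarrow> real) \<Rightarrow> (real ^ 'n) set" where
  "orlicz_ball f = {x. (\<Sum>i\<in>UNIV. f i \<bar>x $ i\<bar>) \<le> 1}"

definition generalized_orlicz_ball :: "(real ^ 'n::finite) set \<Rightarrow> bool" where
  "generalized_orlicz_ball K \<longleftrightarrow> (\<exists>f. (\<forall>i. young_function (f i)) \<and> K = orlicz_ball f)"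

text \<open>The law of a random vector \<open>X\<close> uniformly distributed on \<open>K\<close>. Expectations of functions
  of \<open>X\<close> are integrals against this measure.\<close>

abbreviation uniform_on :: "(real ^ 'n::finite) set \<Rightarrow> (real ^ 'n) measure" where
  "uniform_on K \<equiv> uniform_measure lborel K"

definition isotropic_with :: "real \<Rightarrow> (real ^ 'n::finite) set \<Rightarrow> bool" where
  "isotropic_with L K \<longleftrightarrow> L > 0
     \<and> (\<forall>i. (\<integral>x. x $ i \<partial>uniform_on K) = 0)
     \<and> (\<forall>i j. (\<integral>x. x $ i * x $ j \<partial>uniform_on K) = L\<^sup>2 * (if i = j then 1 else 0))"

definition isotropic :: "(real ^ 'n::finite) set \<Rightarrow> bool" where
  "isotropic K \<longleftrightarrow> emeasure lborel K = 1 \<and> (\<exists>L. isotropic_with L K)"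

definition isotropic_constant :: "(real ^ 'n::finite) set \<Rightarrow> real" where
  "isotropic_constant K = (THE L. isotropic_with L K)"

definition sigma_K :: "(real ^ 'n::finite) set \<Rightarrow> real" where
  "sigma_K K = sqrt (prob_space.variance (uniform_on K) (\<lambda>x. (norm x)\<^sup>2)
                     / (real CARD('n) * isotropic_constant K ^ 4))"

lemma isotropic_constant_eq:
  assumes "isotropic_with L K"
  shows "isotropic_constant K = L"
  unfolding isotropic_constant_def
proof (rule the_equality)
  fix M assume M: "isotropic_with M K"
  have sq: "(\<integral>x. x $ i * x $ i \<partial>uniform_on K) = N\<^sup>2" if "isotropic_with N K" for N i
    using that unfolding isotropic_with_def by simp
  have "M\<^sup>2 = L\<^sup>2"
    using sq[OF M] sq[OF assms] by simp
  moreover have "M > 0" "L > 0"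
    using M assms unfolding isotropic_with_def by blast+
  ultimately show "M = L"
    by (simp add: power2_eq_iff_nonneg)
qed (rule assms)

lemma isotropic_expectation_norm_sq:
  fixes K :: "(real ^ 'n::finite) set"
  assumes "isotropic_with L K"
  shows "(\<integral>x. (norm x)\<^sup>2 \<partial>uniform_on K) = real CARD('n) * L\<^sup>2"
proof -
  have eq: "(\<integral>x. x $ i * x $ i \<partial>uniform_on K) = L\<^sup>2" for i
    using assms unfolding isotropic_with_def by simp
  have "L > 0"
    using assms unfolding isotropic_with_def by blast
  have int: "integrable (uniform_on K) (\<lambda>x. x $ i * x $ i)" for i
  proof (rule ccontr)
    assume "\<not> ?thesis"
    then have "L\<^sup>2 = 0"
      using eq[of i] by (simp add: not_integrable_integral_eq)
    with \<open>L > 0\<close> show False by simp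
  qed
  have "(norm x)\<^sup>2 = (\<Sum>i\<in>UNIV. x $ i * x $ i)" for x :: "real ^ 'n"
    by (simp add: power2_norm_eq_inner inner_vec_def)
  then show ?thesis
    using int eq by simp
qed

text \<open>The two expressions defining \<open>\<sigma>\<^sub>K\<close> agree.\<close>

lemma sigma_K_alt:
  fixes K :: "(real ^ 'n::finite) set"
  assumes "isotropic K"
  shows "sigma_K K = sqrt (real CARD('n) * prob_space.variance (uniform_on K) (\<lambda>x. (norm x)\<^sup>2)
                     / (\<integral>x. (norm x)\<^sup>2 \<partial>uniform_on K)\<^sup>2)"
proof -
  obtain L where L: "isotropic_with L K"
    using assms by (auto simp: isotropic_def)
  have "c * V / (c * L\<^sup>2)\<^sup>2 = V / (c * L ^ 4)" if "c \<noteq> 0" for c V :: real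
    using that by (simp add: power2_eq_square power4_eq_xxxx)
  from this[of "real CARD('n)"] show ?thesis
    unfolding sigma_K_def isotropic_constant_eq[OF L]
    by (simp add: isotropic_expectation_norm_sq[OF L])
qed

end

theory Submission
  imports Defs
begin

text \<open>Write \<open>X\<close> for the uniform random vector and \<open>n\<close> for the dimension. The variance of
  \<open>|X|\<^sup>2\<close> is the sum of all covariances of \<open>X\<^sub>i\<^sup>2\<close> and \<open>X\<^sub>j\<^sup>2\<close>. The theorem holds because these
  covariances are nonpositive for \<open>i \<noteq> j\<close>, while \<open>E X\<^sub>i\<^sup>4 \<le> 6 L\<^sup>4\<close>, so that each of the \<open>n\<close> diagonal
  terms is at most \<open>6 L\<^sup>4 - L\<^sup>4 = 5 L\<^sup>4\<close>.

  Both facts come from one property: the volume \<open>V\<close> of the set where the sum of \<open>f\<^sub>k(|x\<^sub>k|)\<close> over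
  some of the coordinates is at most \<open>r\<close> is a log-concave function of \<open>r\<close>
  (\<open>sublevel_volume_log_concave\<close>). This is proved by induction on the number of coordinates, with a
  one-dimensional Prekopa--Leindler inequality (\<open>prekopa_leindler_radial\<close>) as the step.

  For the covariances, the joint density of two coordinates is \<open>V (1 - f\<^sub>i(|x|) - f\<^sub>j(|y|))\<close>, where
  \<open>V\<close> belongs to the other coordinates. Log-concavity of \<open>V\<close> makes it reverse rule of order two in
  \<open>|x|\<close> and \<open>|y|\<close>, and this implies negative correlation of the squares by Chebyshev's argument
  (\<open>reverse_rule_negative_correlation\<close>).

  For the fourth moment, the density of one coordinate is \<open>V (1 - f\<^sub>i(|x|))\<close>, which is even and
  log-concave. Among such densities the two-sided exponential one has the largest fourth moment for
  a given second moment, and for it the ratio of \<open>E X\<^sup>4\<close> to \<open>(E X\<^sup>2)\<^sup>2\<close> is \<open>4! / (2!)\<^sup>2 = 6\<close>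
  (\<open>log_concave_radial_fourth_moment\<close>).\<close>

section \<open>Log-concave functions on the line\<close>

text \<open>The inequality is multiplicative so that zeros of \<open>w\<close> need no separate treatment: since
  \<open>0 powr a = 0\<close> even for \<open>a = 0\<close>, a vanishing factor makes the left-hand side vanish.\<close>

definition log_concave :: "(real \<Rightarrow> real) \<Rightarrow> bool" where
  "log_concave w \<longleftrightarrow> (\<forall>x. 0 \<le> w x) \<and>
     (\<forall>x y t. 0 \<le> t \<longrightarrow> t \<le> 1 \<longrightarrow>
        w x powr (1 - t) * w y powr t \<le> w ((1 - t) * x + t * y))"

text \<open>Using the condition for \<open>x\<close> and \<open>-x\<close> in both directions shows that such a function is even.\<close>

definition radially_decreasing :: "(real \<Rightarrow> real) \<Rightarrow> bool" where
  "radially_decreasing w \<longleftrightarrow> (\<forall>x y. \<bar>x\<bar> \<le> \<bar>y\<bar> \<longrightarrow> w y \<le> w x)"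

definition bounded_support :: "(real \<Rightarrow> real) \<Rightarrow> bool" where
  "bounded_support w \<longleftrightarrow> (\<exists>R>0. \<forall>x. R < \<bar>x\<bar> \<longrightarrow> w x = 0)"

lemma log_concave_nonneg: "log_concave w \<Longrightarrow> 0 \<le> w x"
  by (simp add: log_concave_def)

lemma log_concaveD:
  "log_concave w \<Longrightarrow> 0 \<le> t \<Longrightarrow> t \<le> 1 \<Longrightarrow>
     w x powr (1 - t) * w y powr t \<le> w ((1 - t) * x + t * y)"
  by (simp add: log_concave_def)

text \<open>Both inner points are convex combinations of the outer ones, with exchanged weights; the two
  instances of log-concavity multiply to the claim. This is how log-concavity of a volume turns into
  a sign condition on pairs of coordinates.\<close>

lemma log_concave_four_points:
  assumes V: "log_concave V" and "p \<le> m" "p \<le> m'" "m + m' = p + q"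
  shows "V p * V q \<le> V m * V m'"
proof (cases "p = q")
  case True
  then have "m = p" "m' = p" using assms by auto
  with True show ?thesis by simp
next
  case False
  then have pq: "p < q" using assms by linarith
  define t where "t = (m - p) / (q - p)"
  have t: "0 \<le> t" "t \<le> 1" using assms pq by (auto simp: t_def field_simps)
  have tm: "t * (q - p) = m - p" using pq by (simp add: t_def)
  have m: "(1 - t) * p + t * q = m" "(1 - (1 - t)) * p + (1 - t) * q = m'"
    using tm assms(4) by (auto simp: algebra_simps)
  have 1: "V p powr (1 - t) * V q powr t \<le> V m"
    using log_concaveD[OF V t, of p q] m by simp
  have 2: "V p powr t * V q powr (1 - t) \<le> V m'"
    using log_concaveD[OF V, of "1 - t" p q] t m by simp
  have "V p * V q = V p powr (1 - t + t) * V q powr (t + (1 - t))"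
    using log_concave_nonneg[OF V] by simp
  also have "\<dots> = (V p powr (1 - t) * V q powr t) * (V p powr t * V q powr (1 - t))"
    by (simp only: powr_add mult_ac)
  also have "\<dots> \<le> V m * V m'"
    by (rule mult_mono[OF 1 2]) (use log_concave_nonneg[OF V] in auto)
  finally show ?thesis .
qed

lemma weighted_arith_geom_mean:
  fixes a b :: real
  assumes "0 \<le> a" "0 \<le> b" "0 \<le> t" "t \<le> 1"
  shows "a powr (1 - t) * b powr t \<le> (1 - t) * a + t * b"
proof (cases "a = 0 \<or> b = 0")
  case True
  then show ?thesis using assms by auto
next
  case False
  then show ?thesis using Youngs_inequality_0[of "1 - t" t a b] assms by auto
qed

section \<open>The Prekopa--Leindler inequality for radially decreasing functions\<close>

text \<open>Fubini for the region under the graph of \<open>F\<close>.\<close>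

lemma layer_cake:
  fixes F :: "real \<Rightarrow> real"
  assumes [measurable]: "F \<in> borel_measurable borel"
  shows "(\<integral>\<^sup>+x. ennreal (F x) \<partial>lborel)
       = (\<integral>\<^sup>+s. indicator {0<..} s * emeasure lborel {x. s < F x} \<partial>lborel)"
proof -
  have "(\<integral>\<^sup>+x. ennreal (F x) \<partial>lborel)
      = (\<integral>\<^sup>+x. (\<integral>\<^sup>+s. indicator {p. 0 < snd p \<and> snd p < F (fst p)} (x, s) \<partial>lborel) \<partial>lborel)"
  proof (rule nn_integral_cong)
    fix x
    have "(\<integral>\<^sup>+s. indicator {p. 0 < snd p \<and> snd p < F (fst p)} (x, s) \<partial>lborel)
        = (\<integral>\<^sup>+s. indicator {0<..<F x} s \<partial>lborel)"
      by (intro nn_integral_cong) (auto simp: indicator_def)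
    also have "\<dots> = ennreal (F x)"
      by (cases "0 \<le> F x") (auto simp: ennreal_neg)
    finally show "ennreal (F x)
      = (\<integral>\<^sup>+s. indicator {p. 0 < snd p \<and> snd p < F (fst p)} (x, s) \<partial>lborel)" by simp
  qed
  also have "\<dots> = (\<integral>\<^sup>+s. (\<integral>\<^sup>+x. indicator {p. 0 < snd p \<and> snd p < F (fst p)} (x, s) \<partial>lborel) \<partial>lborel)"
    by (rule lborel_pair.Fubini'[symmetric]) measurable
  also have "\<dots> = (\<integral>\<^sup>+s. indicator {0<..} s * emeasure lborel {x. s < F x} \<partial>lborel)"
  proof (rule nn_integral_cong)
    fix s
    have "(\<integral>\<^sup>+x. indicator {p. 0 < snd p \<and> snd p < F (fst p)} (x, s) \<partial>lborel)
        = (\<integral>\<^sup>+x. indicator {0<..} s * indicator {x. s < F x} x \<partial>lborel)"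
      by (intro nn_integral_cong) (auto simp: indicator_def)
    also have "\<dots> = indicator {0<..} s * emeasure lborel {x. s < F x}"
      by (subst nn_integral_cmult) (auto intro!: nn_integral_indicator)
    finally show "(\<integral>\<^sup>+x. indicator {p. 0 < snd p \<and> snd p < F (fst p)} (x, s) \<partial>lborel)
        = indicator {0<..} s * emeasure lborel {x. s < F x}" .
  qed
  finally show ?thesis .
qed

text \<open>The Brunn--Minkowski inequality on the line in its simplest case. With \<open>a\<close> and \<open>b\<close> the suprema of
  the absolute values, the closed intervals \<open>[-a, a]\<close> and \<open>[-b, b]\<close> cover \<open>A\<close> and \<open>B\<close>, whereas \<open>C\<close>
  contains the open symmetric interval up to \<open>(1 - t) a + t b\<close>; it remains to compare lengths.\<close>

lemma brunn_minkowski_symmetric: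
  fixes A B C :: "real set"
  assumes A: "A \<noteq> {}" "\<And>x. x \<in> A \<Longrightarrow> \<bar>x\<bar> \<le> R"
    and B: "B \<noteq> {}" "\<And>x. x \<in> B \<Longrightarrow> \<bar>x\<bar> \<le> R"
    and C: "C \<in> sets lborel"
    and t: "0 \<le> t" "t \<le> 1"
    and sum: "\<And>x y z. x \<in> A \<Longrightarrow> y \<in> B \<Longrightarrow> \<bar>z\<bar> \<le> (1 - t) * \<bar>x\<bar> + t * \<bar>y\<bar> \<Longrightarrow> z \<in> C"
  shows "ennreal (1 - t) * emeasure lborel A + ennreal t * emeasure lborel B \<le> emeasure lborel C"
proof -
  define a b where "a = Sup (abs ` A)" and "b = Sup (abs ` B)"
  have bdd: "bdd_above (abs ` A)" "bdd_above (abs ` B)"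
    using A B by (auto intro!: bdd_aboveI[of _ R])
  have xa: "\<bar>x\<bar> \<le> a" if "x \<in> A" for x
    unfolding a_def using that bdd by (intro cSup_upper) auto
  have yb: "\<bar>y\<bar> \<le> b" if "y \<in> B" for y
    unfolding b_def using that bdd by (intro cSup_upper) auto
  have ab: "0 \<le> a" "0 \<le> b"
    using A(1) B(1) xa yb by (auto simp: ex_in_conv[symmetric]) (meson abs_ge_zero order_trans)+
  define m where "m = (1 - t) * a + t * b"
  have m: "0 \<le> m" using ab t by (simp add: m_def)
  have sub: "{-m<..<m} \<subseteq> C"
  proof
    fix z assume "z \<in> {-m<..<m}"
    then have e: "0 < m - \<bar>z\<bar>" by auto
    have "\<exists>x\<in>abs ` A. a - (m - \<bar>z\<bar>) < x"
      using less_cSup_iff[of "abs ` A" "a - (m - \<bar>z\<bar>)"] A(1) bdd e by (auto simp: a_def)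
    then obtain x where x: "x \<in> A" "a - (m - \<bar>z\<bar>) \<le> \<bar>x\<bar>" by force
    have "\<exists>x\<in>abs ` B. b - (m - \<bar>z\<bar>) < x"
      using less_cSup_iff[of "abs ` B" "b - (m - \<bar>z\<bar>)"] B(1) bdd e by (auto simp: b_def)
    then obtain y where y: "y \<in> B" "b - (m - \<bar>z\<bar>) \<le> \<bar>y\<bar>" by force
    have "(1 - t) * (a - (m - \<bar>z\<bar>)) + t * (b - (m - \<bar>z\<bar>)) \<le> (1 - t) * \<bar>x\<bar> + t * \<bar>y\<bar>"
      using x y t by (intro add_mono mult_left_mono) auto
    moreover have "(1 - t) * (a - (m - \<bar>z\<bar>)) + t * (b - (m - \<bar>z\<bar>)) = \<bar>z\<bar>"
      by (simp add: m_def algebra_simps)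
    ultimately show "z \<in> C" using sum x y by simp
  qed
  have "emeasure lborel A \<le> emeasure lborel {-a..a}"
    using xa by (intro emeasure_mono) (auto simp: abs_le_iff minus_le_iff)
  then have eA: "emeasure lborel A \<le> ennreal (2 * a)" using ab by simp
  have "emeasure lborel B \<le> emeasure lborel {-b..b}"
    using yb by (intro emeasure_mono) (auto simp: abs_le_iff minus_le_iff)
  then have eB: "emeasure lborel B \<le> ennreal (2 * b)" using ab by simp
  have "ennreal (1 - t) * emeasure lborel A + ennreal t * emeasure lborel B
      \<le> ennreal (1 - t) * ennreal (2 * a) + ennreal t * ennreal (2 * b)"
    by (intro add_mono mult_left_mono eA eB) auto
  also have "\<dots> = ennreal (2 * m)"
  proof -
    have "(1 - t) * (2 * a) + t * (2 * b) = 2 * m" by (simp add: m_def algebra_simps)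
    then show ?thesis
      using t ab by (simp add: ennreal_mult[symmetric] ennreal_plus[symmetric] del: ennreal_plus)
  qed
  also have "\<dots> = emeasure lborel {-m<..<m}" using m by simp
  also have "\<dots> \<le> emeasure lborel C" using sub C by (intro emeasure_mono) auto
  finally show ?thesis .
qed

text \<open>On the half line the function is monotone, hence Borel, and it factors through the absolute value.\<close>

lemma radially_decreasing_borel_measurable:
  assumes w: "radially_decreasing w"
  shows "w \<in> borel_measurable borel"
proof -
  have "mono (\<lambda>x. - w (max 0 x))"
    using w by (auto simp: mono_def radially_decreasing_def)
  from borel_measurable_mono[OF this]
  have "(\<lambda>x. - (- w (max 0 \<bar>x\<bar>))) \<in> borel_measurable borel"
    by (intro borel_measurable_uminus) (rule measurable_compose[rotated], auto)
  moreover have "w \<bar>x\<bar> = w x" for x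
    using w by (intro antisym) (auto simp: radially_decreasing_def)
  ultimately show ?thesis by simp
qed

lemma radially_decreasing_power_integrable:
  assumes w: "\<And>x. 0 \<le> w x" "radially_decreasing w" "bounded_support w"
  shows "integrable lborel (\<lambda>x. x ^ k * w x)"
proof -
  note [measurable] = radially_decreasing_borel_measurable[OF w(2)]
  obtain R where R: "R > 0" "\<And>x. R < \<bar>x\<bar> \<Longrightarrow> w x = 0" using w(3) by (auto simp: bounded_support_def)
  show ?thesis
  proof (rule integrableI_bounded_set[where A = "{-R..R}" and B = "R ^ k * w 0"])
    show "AE x\<in>{-R..R} in lborel. norm (x ^ k * w x) \<le> R ^ k * w 0"
    proof (intro AE_I2 impI)
      fix x assume "x \<in> {-R..R}"
      then have "\<bar>x\<bar> \<le> R" by auto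
      then show "norm (x ^ k * w x) \<le> R ^ k * w 0"
        using w by (auto simp: abs_mult power_abs radially_decreasing_def intro!: mult_mono power_mono)
    qed
    have "x ^ k * w x = 0" if "x \<notin> {-R..R}" for x
      using R(2)[of x] that by (cases "R < \<bar>x\<bar>") auto
    then show "AE x in lborel. x \<notin> {-R..R} \<longrightarrow> x ^ k * w x = 0" by simp
  qed (use R in \<open>auto simp: less_top[symmetric] emeasure_lborel_Icc\<close>)
qed

text \<open>After division by the maximal values \<open>F 0\<close> and \<open>G 0\<close>, both functions have nonempty superlevel
  sets for exactly the same levels, and the hypothesis puts the weighted mean of these sets into the
  superlevel set of \<open>H\<close>. Brunn--Minkowski at each level, integrated over the levels, bounds the
  integral of \<open>H\<close> below by a weighted arithmetic mean, and so by the geometric mean. Because the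
  superlevel sets are symmetric intervals, only the elementary form of Brunn--Minkowski is needed.\<close>

lemma prekopa_leindler_radial:
  assumes F: "\<And>x. 0 \<le> F x" "radially_decreasing F" "bounded_support F"
    and G: "\<And>x. 0 \<le> G x" "radially_decreasing G" "bounded_support G"
    and H: "\<And>x. 0 \<le> H x" "radially_decreasing H" "bounded_support H"
    and t: "0 \<le> t" "t \<le> 1"
    and FGH: "\<And>x y. F x powr (1 - t) * G y powr t \<le> H ((1 - t) * x + t * y)"
  shows "(\<integral>x. F x \<partial>lborel) powr (1 - t) * (\<integral>x. G x \<partial>lborel) powr t \<le> (\<integral>x. H x \<partial>lborel)"
proof (cases "F 0 = 0 \<or> G 0 = 0")
  case True
  have "F x \<le> F 0" "G x \<le> G 0" for x using F(2) G(2) by (auto simp: radially_decreasing_def)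
  with True have "(\<forall>x. F x = 0) \<or> (\<forall>x. G x = 0)" using F(1) G(1) by (metis order_antisym)
  then show ?thesis using H(1) by (auto intro!: integral_nonneg_AE)
next
  case False
  note [measurable] = radially_decreasing_borel_measurable[OF F(2)]
    radially_decreasing_borel_measurable[OF G(2)] radially_decreasing_borel_measurable[OF H(2)]
  define f g where "f = F 0" and "g = G 0"
  have pos: "0 < f" "0 < g" using False F(1)[of 0] G(1)[of 0] by (auto simp: f_def g_def)
  have Ff: "F x \<le> f" and Gg: "G x \<le> g" for x
    using F(2) G(2) by (auto simp: radially_decreasing_def f_def g_def)
  define h where "h = f powr (1 - t) * g powr t"
  have h: "0 < h" using pos by (simp add: h_def)
  obtain R1 where R1: "\<And>x. R1 < \<bar>x\<bar> \<Longrightarrow> F x = 0" using F(3) by (auto simp: bounded_support_def)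
  obtain R2 where R2: "\<And>x. R2 < \<bar>x\<bar> \<Longrightarrow> G x = 0" using G(3) by (auto simp: bounded_support_def)
  have level: "ennreal (1 - t) * emeasure lborel {x. s < F x / f} + ennreal t * emeasure lborel {x. s < G x / g}
        \<le> emeasure lborel {x. s < H x / h}" if s: "0 < s" for s
  proof (cases "s < 1")
    case True
    show ?thesis
    proof (rule brunn_minkowski_symmetric[where R = "max R1 R2"])
      show "{x. s < F x / f} \<noteq> {}" "{x. s < G x / g} \<noteq> {}"
        using True pos by (auto simp: f_def g_def intro!: exI[of _ 0])
      show "\<bar>x\<bar> \<le> max R1 R2" if "x \<in> {x. s < F x / f}" for x
        using that R1[of x] s by force
      show "\<bar>x\<bar> \<le> max R1 R2" if "x \<in> {x. s < G x / g}" for x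
        using that R2[of x] s by force
      fix x y z
      assume x: "x \<in> {x. s < F x / f}" and y: "y \<in> {x. s < G x / g}"
        and z: "\<bar>z\<bar> \<le> (1 - t) * \<bar>x\<bar> + t * \<bar>y\<bar>"
      have xx: "s * f < F \<bar>x\<bar>" "s * g < G \<bar>y\<bar>"
        using x y pos F(2) G(2) unfolding radially_decreasing_def
        by (auto simp: field_simps intro: less_le_trans)
      have "s * h = (s * f) powr (1 - t) * (s * g) powr t"
      proof -
        have "s powr (1 - t) * s powr t = s" using s by (simp flip: powr_add)
        then show ?thesis using s pos by (simp add: h_def powr_mult)
      qed
      also have "\<dots> < F \<bar>x\<bar> powr (1 - t) * G \<bar>y\<bar> powr t"
      proof (cases "t = 0")
        case True
        have "0 < s * g" using s pos by simp
        then have "0 < G \<bar>y\<bar>" using xx(2) by linarith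
        with True show ?thesis using xx s pos by simp
      next
        case False
        have "(s * g) powr t < G \<bar>y\<bar> powr t"
          using xx s pos False t by (intro powr_less_mono2) auto
        moreover have "(s * f) powr (1 - t) \<le> F \<bar>x\<bar> powr (1 - t)"
          using xx s pos t by (intro powr_mono2) auto
        ultimately show ?thesis using s pos
          by (intro mult_le_less_imp_less) auto
      qed
      also have "\<dots> \<le> H ((1 - t) * \<bar>x\<bar> + t * \<bar>y\<bar>)" by (rule FGH)
      also have "\<dots> \<le> H z" using H(2) z t by (simp add: radially_decreasing_def)
      finally show "z \<in> {x. s < H x / h}" using h by (simp add: field_simps)
    qed (use t in auto)
  next
    case False
    \<comment> \<open>Above level 1 both superlevel sets on the left are empty.\<close>
    have "F x / f \<le> 1" "G x / g \<le> 1" for x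
      using Ff[of x] Gg[of x] pos by simp_all
    with False have "F x / f \<le> s" "G x / g \<le> s" for x
      by (meson not_less order_trans)+
    then have "{x. s < F x / f} = {}" "{x. s < G x / g} = {}"
      by (auto simp: not_less)
    then show ?thesis by simp
  qed
  have int: "integrable lborel F" "integrable lborel G" "integrable lborel H"
    using radially_decreasing_power_integrable[of F 0] radially_decreasing_power_integrable[of G 0]
      radially_decreasing_power_integrable[of H 0] F G H by simp_all
  have nn: "(\<integral>\<^sup>+x. ennreal (w x / c) \<partial>lborel) = ennreal ((\<integral>x. w x \<partial>lborel) / c)"
    if "integrable lborel w" "\<And>x. 0 \<le> w x" "0 < c" for w :: "real \<Rightarrow> real" and c :: real
    using that by (subst nn_integral_eq_integral) auto
  have "ennreal (1 - t) * (\<integral>\<^sup>+x. ennreal (F x / f) \<partial>lborel) + ennreal t * (\<integral>\<^sup>+x. ennreal (G x / g) \<partial>lborel)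
      \<le> (\<integral>\<^sup>+x. ennreal (H x / h) \<partial>lborel)"
  proof -
    have [measurable]: "(\<lambda>s. emeasure lborel {x. s < w x / c}) \<in> borel_measurable borel"
      if [measurable]: "w \<in> borel_measurable borel" for w :: "real \<Rightarrow> real" and c :: real
    proof -
      have "{p \<in> space (lborel \<Otimes>\<^sub>M lborel). fst p < w (snd p) / c} \<in> sets (lborel \<Otimes>\<^sub>M lborel)"
        by measurable
      then have "(\<lambda>s. emeasure lborel (Pair s -` {p. fst p < w (snd p) / c})) \<in> borel_measurable lborel"
        by (intro lborel.measurable_emeasure_Pair) (simp add: space_pair_measure)
      then show ?thesis by (simp add: vimage_def)
    qed
    show ?thesis
      unfolding layer_cake[of "\<lambda>x. F x / f", simplified] layer_cake[of "\<lambda>x. G x / g", simplified]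
        layer_cake[of "\<lambda>x. H x / h", simplified]
      using level
      by (subst (1 2) nn_integral_cmult[symmetric], measurable)
        (subst nn_integral_add[symmetric], auto intro!: nn_integral_mono simp: indicator_def)
  qed
  then have "ennreal ((1 - t) * ((\<integral>x. F x \<partial>lborel) / f) + t * ((\<integral>x. G x \<partial>lborel) / g))
      \<le> ennreal ((\<integral>x. H x \<partial>lborel) / h)"
    using t pos F(1) G(1)
    by (simp add: nn int F(1) G(1) H(1) h ennreal_mult[symmetric] ennreal_plus[symmetric]
          integral_nonneg_AE del: ennreal_plus)
  then have le: "(1 - t) * ((\<integral>x. F x \<partial>lborel) / f) + t * ((\<integral>x. G x \<partial>lborel) / g) \<le> (\<integral>x. H x \<partial>lborel) / h"
    using H(1) h by (subst (asm) ennreal_le_iff) (auto intro!: integral_nonneg_AE divide_nonneg_pos)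
  have "((\<integral>x. F x \<partial>lborel) / f) powr (1 - t) * ((\<integral>x. G x \<partial>lborel) / g) powr t
      \<le> (\<integral>x. H x \<partial>lborel) / h"
    by (rule order_trans[OF weighted_arith_geom_mean le])
      (use t pos F(1) G(1) in \<open>auto intro!: divide_nonneg_pos integral_nonneg_AE\<close>)
  then show ?thesis
    using h pos F(1) G(1) by (simp add: powr_divide integral_nonneg_AE h_def field_simps)
qed

section \<open>Negative correlation from a sign condition\<close>

lemma integral_nonpos:
  fixes f :: "'a \<Rightarrow> real"
  assumes "\<And>x. f x \<le> 0"
  shows "(\<integral>x. f x \<partial>M) \<le> 0"
  using integral_nonneg_AE[where M = M and f = "\<lambda>x. - f x"] assms by simp

text \<open>Chebyshev's argument: integrating the sign condition over independent \<open>p\<close> and \<open>q\<close> gives twice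
  the difference of the two sides. The integration is done one variable at a time, so that linearity
  of the integral suffices and no product measure occurs.\<close>

lemma integral_correlation_mono:
  fixes a b g :: "'a \<Rightarrow> real"
  assumes int: "integrable M a" "integrable M b" "integrable M (\<lambda>x. g x * a x)" "integrable M (\<lambda>x. g x * b x)"
    and cross: "\<And>p q. (g p - g q) * (b p * a q - b q * a p) \<le> 0"
  shows "(\<integral>x. g x * b x \<partial>M) * (\<integral>x. a x \<partial>M) \<le> (\<integral>x. g x * a x \<partial>M) * (\<integral>x. b x \<partial>M)"
proof -
  let ?A = "\<integral>x. a x \<partial>M" and ?B = "\<integral>x. b x \<partial>M"
    and ?GA = "\<integral>x. g x * a x \<partial>M" and ?GB = "\<integral>x. g x * b x \<partial>M"
  have inner: "a q * ?GB - b q * ?GA - g q * a q * ?B + g q * b q * ?A \<le> 0" for q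
  proof -
    have "(\<integral>p. a q * (g p * b p) - b q * (g p * a p) - g q * a q * b p + g q * b q * a p \<partial>M)
        = a q * ?GB - b q * ?GA - g q * a q * ?B + g q * b q * ?A"
      using int by simp
    moreover have "(\<integral>p. a q * (g p * b p) - b q * (g p * a p) - g q * a q * b p + g q * b q * a p \<partial>M) \<le> 0"
      using cross[of _ q] by (intro integral_nonpos) (simp add: algebra_simps)
    ultimately show ?thesis by simp
  qed
  have "(\<integral>q. ?GB * a q - ?GA * b q - ?B * (g q * a q) + ?A * (g q * b q) \<partial>M)
      = ?GB * ?A - ?GA * ?B - ?B * ?GA + ?A * ?GB"
    using int by simp
  moreover have "(\<integral>q. ?GB * a q - ?GA * b q - ?B * (g q * a q) + ?A * (g q * b q) \<partial>M) \<le> 0"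
    using inner by (intro integral_nonpos) (simp add: algebra_simps)
  ultimately show ?thesis by (simp add: algebra_simps)
qed

text \<open>The last hypothesis says that a large value of one coordinate favours small values of the other.
  Chebyshev's argument is used twice: for two fixed values of \<open>x\<close> it shows that the conditional mean
  of \<open>y\<^sup>2\<close> given \<open>x\<close> is nonincreasing in the absolute value of \<open>x\<close>, and this monotonicity is the sign
  condition for integrating over \<open>x\<close>.\<close>

lemma reverse_rule_negative_correlation:
  fixes W :: "real \<Rightarrow> real \<Rightarrow> real"
  assumes W0: "\<And>x y. 0 \<le> W x y"
    and dec: "\<And>x. radially_decreasing (W x)" "\<And>y. radially_decreasing (\<lambda>x. W x y)"
    and R: "R > 0" "\<And>x y. R < \<bar>x\<bar> \<or> R < \<bar>y\<bar> \<Longrightarrow> W x y = 0"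
    and rule: "\<And>x x' y y'. \<bar>x\<bar> \<le> \<bar>x'\<bar> \<Longrightarrow> \<bar>y\<bar> \<le> \<bar>y'\<bar> \<Longrightarrow> W x y * W x' y' \<le> W x y' * W x' y"
  shows "(\<integral>x. x\<^sup>2 * (\<integral>y. y\<^sup>2 * W x y \<partial>lborel) \<partial>lborel) * (\<integral>x. (\<integral>y. W x y \<partial>lborel) \<partial>lborel)
       \<le> (\<integral>x. x\<^sup>2 * (\<integral>y. W x y \<partial>lborel) \<partial>lborel) * (\<integral>x. (\<integral>y. y\<^sup>2 * W x y \<partial>lborel) \<partial>lborel)"
proof -
  define M where "M k x = (\<integral>y. y ^ k * W x y \<partial>lborel)" for k x
  have intW: "integrable lborel (\<lambda>y. y ^ k * W x y)" for k x
    using R by (intro radially_decreasing_power_integrable W0 dec) (auto simp: bounded_support_def)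
  have intM: "integrable lborel (\<lambda>x. x ^ n * M k x)" if k: "even k" for n k
  proof (rule radially_decreasing_power_integrable)
    show "0 \<le> M k x" for x
      unfolding M_def using W0 k by (intro integral_nonneg_AE AE_I2) (auto simp: zero_le_even_power)
    show "radially_decreasing (M k)"
      unfolding radially_decreasing_def M_def using dec(2) k
      by (intro allI impI integral_mono intW mult_left_mono)
         (auto simp: radially_decreasing_def zero_le_even_power)
    show "bounded_support (M k)"
      unfolding bounded_support_def M_def using R by (intro exI[of _ R]) auto
  qed
  have conditional: "M 2 p * M 0 q \<le> M 2 q * M 0 p" if pq: "\<bar>q\<bar> \<le> \<bar>p\<bar>" for p q
  proof -
    have "(y\<^sup>2 - z\<^sup>2) * (W p y * W q z - W p z * W q y) \<le> 0" for y z
    proof (cases "\<bar>y\<bar> \<le> \<bar>z\<bar>")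
      case True
      then show ?thesis using rule[OF pq True] abs_le_square_iff[of y z]
        by (intro mult_nonpos_nonneg) (auto simp: mult_ac)
    next
      case False
      then show ?thesis using rule[OF pq, of z y] abs_le_square_iff[of z y]
        by (intro mult_nonneg_nonpos) (auto simp: mult_ac)
    qed
    from integral_correlation_mono[OF _ _ _ _ this, of lborel] show ?thesis
      using intW[of 0 q] intW[of 0 p] intW[of 2 q] intW[of 2 p] by (simp add: M_def)
  qed
  have "(p\<^sup>2 - q\<^sup>2) * (M 2 p * M 0 q - M 2 q * M 0 p) \<le> 0" for p q
  proof (cases "\<bar>q\<bar> \<le> \<bar>p\<bar>")
    case True
    then show ?thesis using conditional[OF True] abs_le_square_iff[of q p]
      by (intro mult_nonneg_nonpos) auto
  next
    case False
    then show ?thesis using conditional[of p q] abs_le_square_iff[of p q]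
      by (intro mult_nonpos_nonneg) auto
  qed
  from integral_correlation_mono[OF _ _ _ _ this, of lborel] show ?thesis
    using intM[of 0 0] intM[of 2 0] intM[of 0 2] intM[of 2 2] by (simp add: M_def)
qed

section \<open>The fourth moment of a log-concave density\<close>

lemma exponential_density_moment:
  fixes l :: real assumes l: "0 < l"
  shows "has_bochner_integral lborel (\<lambda>x. x ^ k * exponential_density l x) (fact k / l ^ k)"
proof (rule has_bochner_integral_nn_integral)
  show "(\<integral>\<^sup>+ x. ennreal (x ^ k * exponential_density l x) \<partial>lborel) = ennreal (fact k / l ^ k)"
    using nn_integral_erlang_ith_moment[OF l, of 0 k] by (simp add: mult.commute)
  show "AE x in lborel. 0 \<le> x ^ k * exponential_density l x"
    using l by (auto simp: exponential_density_def erlang_density_def)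
qed (use l in auto)

lemma integral_even:
  fixes f :: "real \<Rightarrow> real"
  assumes int: "integrable lborel f" and even: "\<And>x. f (- x) = f x"
  shows "(\<integral>x. f x \<partial>lborel) = 2 * (\<integral>x. indicator {0..} x * f x \<partial>lborel)"
proof -
  have i1: "integrable lborel (\<lambda>x. indicator {0..} x * f x)"
    "integrable lborel (\<lambda>x. indicator {..0} x * f x)"
    using int integrable_mult_indicator[of _ lborel f] by auto
  have "(\<integral>x. indicator {0..} x * f x \<partial>lborel) = (\<integral>x. indicator {..0} x * f x \<partial>lborel)"
    by (subst lborel_integral_real_affine[where c="-1" and t=0])
       (auto intro!: Bochner_Integration.integral_cong simp: even split: split_indicator)
  moreover have "(\<integral>x. f x \<partial>lborel) = (\<integral>x. indicator {0..} x * f x + indicator {..0} x * f x \<partial>lborel)"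
  proof (rule integral_cong_AE)
    show "AE x in lborel. f x = indicator {0..} x * f x + indicator {..0} x * f x"
      using AE_lborel_singleton[of "0::real"] by eventually_elim (auto split: split_indicator)
  qed (use int i1 in \<open>auto intro: borel_measurable_integrable\<close>)
  ultimately show ?thesis using i1 by simp
qed

text \<open>An exponential is log-linear, so that a log-concave function that dominates it at two points
  dominates it in between.\<close>

lemma log_concave_exponential_superlevel_convex:
  assumes w: "log_concave w" and k: "0 < k"
    and x: "k * exp (- l * x) \<le> w x" and y: "k * exp (- l * y) \<le> w y" and z: "x \<le> z" "z \<le> y"
  shows "k * exp (- l * z) \<le> w z"
proof (cases "x = y")
  case True
  then show ?thesis using x z by simp
next
  case False
  then have xy: "x < y" using z by simp
  define t where "t = (z - x) / (y - x)"
  have t: "0 \<le> t" "t \<le> 1" using xy z by (auto simp: t_def)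
  have "t * (y - x) = z - x" using xy by (simp add: t_def)
  then have zt: "z = (1 - t) * x + t * y" by (simp add: algebra_simps)
  have "k powr (1 - t) * k powr t = k" using k by (simp flip: powr_add)
  then have "k * exp (- l * z) = (k * exp (- l * x)) powr (1 - t) * (k * exp (- l * y)) powr t"
    using k by (simp add: zt powr_mult exp_powr_real exp_add[symmetric] algebra_simps)
  also have "\<dots> \<le> w x powr (1 - t) * w y powr t"
    using x y k t by (intro mult_mono powr_mono2) auto
  also have "\<dots> \<le> w z" using log_concaveD[OF w t] by (simp add: zt)
  finally show ?thesis .
qed

text \<open>Let \<open>D\<close> be the difference between \<open>w\<close> and the multiple of an exponential density that has the same
  moments of order 0 and 2. On the half line, by log-concavity, \<open>D\<close> is nonnegative on an interval with
  end points \<open>\<alpha>\<close> and \<open>\<beta>\<close> and negative outside it, just opposite to the polynomial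
  \<open>(x\<^sup>2 - \<alpha>\<^sup>2) (x\<^sup>2 - \<beta>\<^sup>2)\<close>. Integrating the product leaves only the fourth moment of \<open>D\<close>, which is
  therefore at most 0, and exponential densities satisfy the claim with equality.\<close>

lemma log_concave_half_line_fourth_moment:
  fixes w :: "real \<Rightarrow> real"
  assumes w: "log_concave w" and supp: "bounded_support w"
    and int: "\<And>k. integrable lborel (\<lambda>x. x ^ k * w x)"
  defines "m \<equiv> \<lambda>k. \<integral>x. indicator {0..} x * (x ^ k * w x) \<partial>lborel"
  shows "m 4 * m 0 \<le> 6 * (m 2)\<^sup>2"
proof -
  obtain R where R: "R > 0" "\<And>x. R < \<bar>x\<bar> \<Longrightarrow> w x = 0"
    using supp by (auto simp: bounded_support_def)
  have w0: "0 \<le> w x" for x by (rule log_concave_nonneg[OF w])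
  have i: "integrable lborel (\<lambda>x. indicator {0..} x * (x ^ k * w x))" for k
    using integrable_mult_indicator[OF _ int[of k], of "{0..}"] by simp
  have m0: "0 \<le> m k" for k
    unfolding m_def using w0 by (intro integral_nonneg_AE AE_I2) (auto split: split_indicator)
  have m4: "m 4 \<le> R\<^sup>2 * m 2"
    unfolding m_def integral_mult_right_zero[symmetric]
  proof (rule integral_mono)
    fix x
    show "indicator {0..} x * (x ^ 4 * w x) \<le> R\<^sup>2 * (indicator {0..} x * (x\<^sup>2 * w x))"
    proof (cases "R < \<bar>x\<bar>")
      case False
      then have "x\<^sup>2 \<le> R\<^sup>2" by (intro abs_le_square_iff[THEN iffD1]) auto
      then have "x\<^sup>2 * (x\<^sup>2 * w x) \<le> R\<^sup>2 * (x\<^sup>2 * w x)" using w0 by (intro mult_right_mono) auto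
      then show ?thesis by (auto split: split_indicator simp: power4_eq_xxxx power2_eq_square mult_ac)
    qed (use R in auto)
  qed (use i in auto)
  show ?thesis
  proof (cases "m 0 = 0 \<or> m 2 = 0")
    case True
    then show ?thesis using m4 m0[of 4] by auto
  next
    case False
    then have mp: "0 < m 0" "0 < m 2" using m0[of 0] m0[of 2] by auto
    \<comment> \<open>The rate for which \<open>m 0\<close> times the exponential density has second moment \<open>2 * m 0 / l\<^sup>2 = m 2\<close>.\<close>
    define l where "l = sqrt (2 * m 0 / m 2)"
    have l: "0 < l" "l\<^sup>2 = 2 * m 0 / m 2" using mp by (auto simp: l_def)
    define D where "D x = indicator {0..} x * w x - m 0 * exponential_density l x" for x
    have hasD: "has_bochner_integral lborel (\<lambda>x. x ^ k * D x) (m k - m 0 * (fact k / l ^ k))" for k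
    proof -
      have "has_bochner_integral lborel (\<lambda>x. indicator {0..} x * (x ^ k * w x) - m 0 * (x ^ k * exponential_density l x))
         (m k - m 0 * (fact k / l ^ k))"
        unfolding m_def
        by (intro has_bochner_integral_diff has_bochner_integral_mult_right exponential_density_moment l
              has_bochner_integral_integrable i)
      then show ?thesis by (simp add: D_def algebra_simps)
    qed
    have D0: "(\<integral>x. D x \<partial>lborel) = 0" "integrable lborel D"
      using hasD[of 0] by (auto simp: has_bochner_integral_iff)
    have D2: "(\<integral>x. x\<^sup>2 * D x \<partial>lborel) = 0" "integrable lborel (\<lambda>x. x\<^sup>2 * D x)"
      using hasD[of 2] mp by (auto simp: has_bochner_integral_iff l fact_numeral)
    have l4: "l ^ 4 = 4 * (m 0)\<^sup>2 / (m 2)\<^sup>2"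
    proof -
      have "l ^ 4 = (l\<^sup>2)\<^sup>2" by simp
      then show ?thesis unfolding l by (simp add: power_divide power_mult_distrib)
    qed
    have D4: "(\<integral>x. x ^ 4 * D x \<partial>lborel) = m 4 - 6 * (m 2)\<^sup>2 / m 0" "integrable lborel (\<lambda>x. x ^ 4 * D x)"
      using hasD[of 4] mp by (auto simp: has_bochner_integral_iff l4 fact_numeral power2_eq_square)
    define S where "S = {x. 0 \<le> x \<and> 0 \<le> D x}"
    have Dpos: "0 \<le> D x \<longleftrightarrow> m 0 * l * exp (- l * x) \<le> w x" if "0 \<le> x" for x
      using that by (simp add: D_def exponential_density_def erlang_density_def mult_ac)
    have D_neg_arg: "D x = 0" if "x < 0" for x
      using that by (simp add: D_def exponential_density_def erlang_density_def)
    have S_le: "0 \<le> x \<and> x \<le> R" if "x \<in> S" for x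
    proof -
      have "0 < m 0 * l * exp (- l * x)" using mp l by simp
      then have "w x \<noteq> 0" using that Dpos[of x] by (auto simp: S_def)
      then show ?thesis using that R(2)[of x] by (force simp: S_def)
    qed
    have "\<exists>\<alpha> \<beta>. \<forall>x. (x\<^sup>2 - \<alpha>\<^sup>2) * (x\<^sup>2 - \<beta>\<^sup>2) * D x \<le> 0"
    proof (cases "S = {}")
      case True
      \<comment> \<open>With no sign change at all, \<open>\<alpha> = \<beta> = 0\<close> serves.\<close>
      have "(x\<^sup>2 - 0\<^sup>2) * (x\<^sup>2 - 0\<^sup>2) * D x \<le> 0" for x
      proof -
        have "D x \<le> 0" using True D_neg_arg[of x] unfolding S_def by (cases "x < 0") (simp, smt (verit) empty_Collect_eq)
        then show ?thesis by (auto simp: mult_nonneg_nonpos)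
      qed
      then show ?thesis by blast
    next
      case False
      define \<alpha> \<beta> where "\<alpha> = Inf S" and "\<beta> = Sup S"
      have bdd: "bdd_below S" "bdd_above S" using S_le by (auto intro!: bdd_belowI[of _ 0] bdd_aboveI[of _ R])
      have ab: "0 \<le> \<alpha>" "\<alpha> \<le> \<beta>"
        unfolding \<alpha>_def \<beta>_def using False S_le bdd by (auto intro: cInf_greatest cInf_le_cSup)
      have "(x\<^sup>2 - \<alpha>\<^sup>2) * (x\<^sup>2 - \<beta>\<^sup>2) * D x \<le> 0" if x: "0 \<le> x" for x
      proof (cases "\<alpha> < x \<and> x < \<beta>")
        case True
        obtain p where p: "p \<in> S" "p < x"
          using True cInf_less_iff[OF False bdd(1)] by (auto simp: \<alpha>_def)
        obtain q where q: "q \<in> S" "x < q"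
          using True less_cSup_iff[OF False bdd(2)] by (auto simp: \<beta>_def)
        have "m 0 * l * exp (- l * x) \<le> w x"
          using p q Dpos[of p] Dpos[of q] mp l
          by (intro log_concave_exponential_superlevel_convex[OF w, of _ l p q x]) (auto simp: S_def)
        then have "0 \<le> D x" using Dpos x by simp
        moreover have "\<alpha>\<^sup>2 \<le> x\<^sup>2" "x\<^sup>2 \<le> \<beta>\<^sup>2" using True x ab by (auto intro!: power_mono)
        ultimately show ?thesis by (intro mult_nonpos_nonneg mult_nonneg_nonpos) auto
      next
        case outside: False
        have "0 \<le> (x\<^sup>2 - \<alpha>\<^sup>2) * (x\<^sup>2 - \<beta>\<^sup>2)"
        proof (cases "x \<le> \<alpha>")
          case True
          then have "x\<^sup>2 \<le> \<alpha>\<^sup>2" "x\<^sup>2 \<le> \<beta>\<^sup>2" using x ab by (auto intro!: power_mono)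
          then show ?thesis by (intro mult_nonpos_nonpos) auto
        next
          case False
          then have "\<alpha>\<^sup>2 \<le> x\<^sup>2" "\<beta>\<^sup>2 \<le> x\<^sup>2" using outside x ab by (auto intro!: power_mono)
          then show ?thesis by simp
        qed
        moreover have "D x \<le> 0 \<or> x = \<alpha> \<or> x = \<beta>"
        proof (rule ccontr)
          assume *: "\<not> ?thesis"
          then have "x \<in> S" using x by (simp add: S_def)
          then have "\<alpha> \<le> x" "x \<le> \<beta>"
            unfolding \<alpha>_def \<beta>_def using bdd by (auto intro: cInf_lower cSup_upper)
          with * outside show False by auto
        qed
        ultimately show ?thesis by (auto simp: mult_nonneg_nonpos)
      qed
      then have "(x\<^sup>2 - \<alpha>\<^sup>2) * (x\<^sup>2 - \<beta>\<^sup>2) * D x \<le> 0" for x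
        using D_neg_arg[of x] by (cases "x < 0") auto
      then show ?thesis by blast
    qed
    then obtain \<alpha> \<beta> where sign: "\<And>x. (x\<^sup>2 - \<alpha>\<^sup>2) * (x\<^sup>2 - \<beta>\<^sup>2) * D x \<le> 0" by blast
    have "(\<integral>x. x ^ 4 * D x - (\<alpha>\<^sup>2 + \<beta>\<^sup>2) * (x\<^sup>2 * D x) + \<alpha>\<^sup>2 * \<beta>\<^sup>2 * D x \<partial>lborel)
        = m 4 - 6 * (m 2)\<^sup>2 / m 0"
      using D0 D2 D4 by simp
    moreover have "(\<integral>x. x ^ 4 * D x - (\<alpha>\<^sup>2 + \<beta>\<^sup>2) * (x\<^sup>2 * D x) + \<alpha>\<^sup>2 * \<beta>\<^sup>2 * D x \<partial>lborel) \<le> 0"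
    proof (intro integral_nonpos)
      fix x
      show "x ^ 4 * D x - (\<alpha>\<^sup>2 + \<beta>\<^sup>2) * (x\<^sup>2 * D x) + \<alpha>\<^sup>2 * \<beta>\<^sup>2 * D x \<le> 0"
        using sign[of x] by (simp add: algebra_simps power4_eq_xxxx power2_eq_square)
    qed
    ultimately have "m 4 \<le> 6 * (m 2)\<^sup>2 / m 0" by simp
    then show ?thesis using mp by (simp add: field_simps)
  qed
qed

lemma log_concave_radial_fourth_moment:
  fixes w :: "real \<Rightarrow> real"
  assumes w: "log_concave w" "radially_decreasing w" "bounded_support w"
  shows "(\<integral>x. x ^ 4 * w x \<partial>lborel) * (\<integral>x. w x \<partial>lborel) \<le> 6 * (\<integral>x. x\<^sup>2 * w x \<partial>lborel)\<^sup>2"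
proof -
  have int: "integrable lborel (\<lambda>x. x ^ k * w x)" for k
    by (intro radially_decreasing_power_integrable w log_concave_nonneg)
  have even: "w (- x) = w x" for x
    using w(2) by (intro antisym) (auto simp: radially_decreasing_def)
  define m where "m k = (\<integral>x. indicator {0..} x * (x ^ k * w x) \<partial>lborel)" for k :: nat
  have "(\<integral>x. x ^ k * w x \<partial>lborel) = 2 * m k" if "even k" for k
    unfolding m_def using integral_even[OF int[of k]] that by (simp add: even)
  from this[of 0] this[of 2] this[of 4] show ?thesis
    using log_concave_half_line_fourth_moment[OF w(1,3) int]
    by (simp add: m_def power_mult_distrib mult.commute)
qed

section \<open>Young functions of the absolute value\<close>

lemma young_nonneg: "young_function f \<Longrightarrow> 0 \<le> x \<Longrightarrow> 0 \<le> f x"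
  by (auto simp: young_function_def)

lemma young_abs_mono:
  assumes "young_function f" "\<bar>x\<bar> \<le> \<bar>y\<bar>"
  shows "f \<bar>x\<bar> \<le> f \<bar>y\<bar>"
  using assms strict_mono_on_leD[of "{0..}" f "\<bar>x\<bar>" "\<bar>y\<bar>"] by (simp add: young_function_def)

lemma young_abs_convex:
  assumes f: "young_function f" and t: "0 \<le> t" "t \<le> 1"
  shows "f \<bar>(1 - t) * x + t * y\<bar> \<le> (1 - t) * f \<bar>x\<bar> + t * f \<bar>y\<bar>"
proof -
  have "\<bar>(1 - t) * x + t * y\<bar> \<le> (1 - t) * \<bar>x\<bar> + t * \<bar>y\<bar>"
    using t abs_triangle_ineq[of "(1 - t) * x" "t * y"] by (simp add: abs_mult)
  then have "f \<bar>(1 - t) * x + t * y\<bar> \<le> f ((1 - t) * \<bar>x\<bar> + t * \<bar>y\<bar>)"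
    using young_abs_mono[OF f, of "(1 - t) * x + t * y" "(1 - t) * \<bar>x\<bar> + t * \<bar>y\<bar>"] t by simp
  also have "\<dots> \<le> (1 - t) * f \<bar>x\<bar> + t * f \<bar>y\<bar>"
    using f t convex_onD[of "{0..}" f t "\<bar>x\<bar>" "\<bar>y\<bar>"] by (simp add: young_function_def)
  finally show ?thesis .
qed

text \<open>Convexity and the value 0 at 0 force at least linear growth with slope \<open>f 1\<close> beyond 1.\<close>

lemma young_coercive:
  assumes f: "young_function f"
  shows "\<exists>R>0. \<forall>x. R < \<bar>x\<bar> \<longrightarrow> r < f \<bar>x\<bar>"
proof -
  have f0: "f 0 = 0" and f1: "0 < f 1"
    using f strict_mono_onD[of "{0..}" f 0 1] by (auto simp: young_function_def)
  define R where "R = max 1 (r / f 1)"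
  have "r < f \<bar>x\<bar>" if x: "R < \<bar>x\<bar>" for x
  proof -
    have x1: "1 < \<bar>x\<bar>" "r / f 1 < \<bar>x\<bar>" using x by (auto simp: R_def)
    have "f \<bar>(1 - 1 / \<bar>x\<bar>) * 0 + (1 / \<bar>x\<bar>) * x\<bar> \<le> (1 - 1 / \<bar>x\<bar>) * f \<bar>0\<bar> + (1 / \<bar>x\<bar>) * f \<bar>x\<bar>"
      using x1 by (intro young_abs_convex f) auto
    then have "f 1 \<le> f \<bar>x\<bar> / \<bar>x\<bar>" using f0 x1 by (cases "x = 0") (auto simp: abs_mult)
    then have "\<bar>x\<bar> * f 1 \<le> f \<bar>x\<bar>" using x1 by (simp add: field_simps)
    moreover have "r < \<bar>x\<bar> * f 1" using x1(2) f1 by (simp add: field_simps)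
    ultimately show ?thesis by simp
  qed
  moreover have "0 < R" by (simp add: R_def)
  ultimately show ?thesis by blast
qed

lemma young_abs_borel_measurable:
  assumes "young_function f"
  shows "(\<lambda>x. f \<bar>x\<bar>) \<in> borel_measurable borel"
proof -
  have "radially_decreasing (\<lambda>x. - f \<bar>x\<bar>)"
    using young_abs_mono[OF assms] by (auto simp: radially_decreasing_def)
  from borel_measurable_uminus[OF radially_decreasing_borel_measurable[OF this]] show ?thesis by simp
qed

section \<open>Volumes of sublevel sets\<close>

text \<open>Volumes are studied over an arbitrary finite index set, because the induction removes coordinates
  one at a time, and at every level \<open>r\<close>, because fixing a coordinate lowers the level.\<close>

definition sublevel :: "('i \<Rightarrow> real \<Rightarrow> real) \<Rightarrow> 'i set \<Rightarrow> real \<Rightarrow> ('i \<Rightarrow> real) set" where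
  "sublevel f I r = {x. (\<Sum>i\<in>I. f i \<bar>x i\<bar>) \<le> r}"

definition sublevel_integral ::
    "('i \<Rightarrow> real \<Rightarrow> real) \<Rightarrow> 'i set \<Rightarrow> (('i \<Rightarrow> real) \<Rightarrow> ennreal) \<Rightarrow> real \<Rightarrow> ennreal" where
  "sublevel_integral f I h r = (\<integral>\<^sup>+x. h x * indicator (sublevel f I r) x \<partial>Pi\<^sub>M I (\<lambda>_. lborel))"

definition sublevel_volume :: "('i \<Rightarrow> real \<Rightarrow> real) \<Rightarrow> 'i set \<Rightarrow> real \<Rightarrow> real" where
  "sublevel_volume f I r = enn2real (sublevel_integral f I (\<lambda>_. 1) r)"

lemma sublevel_measurable:
  assumes f: "\<forall>i\<in>I. young_function (f i)"
  shows "{x \<in> space (Pi\<^sub>M I (\<lambda>_. lborel)). x \<in> sublevel f I r} \<in> sets (Pi\<^sub>M I (\<lambda>_. lborel))"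
proof -
  have [measurable]: "(\<lambda>x. f i \<bar>x i\<bar>) \<in> borel_measurable (Pi\<^sub>M I (\<lambda>_. lborel))" if i: "i \<in> I" for i
  proof -
    have "(\<lambda>x. x i) \<in> measurable (Pi\<^sub>M I (\<lambda>_. lborel)) lborel" using i by measurable
    moreover have "(\<lambda>x. f i \<bar>x\<bar>) \<in> borel_measurable lborel"
      using young_abs_borel_measurable[of "f i"] f i by simp
    ultimately show ?thesis by (rule measurable_compose)
  qed
  show ?thesis unfolding sublevel_def mem_Collect_eq by measurable
qed

text \<open>Integrating out one coordinate: fixing \<open>x i = y\<close> consumes \<open>f i \<bar>y\<bar>\<close> of the level. The factor \<open>h\<close>
  stands for a function of the other coordinates, measurable on both product spaces.\<close>

lemma sublevel_integral_insert:
  assumes I: "finite I" "i \<notin> I" and f: "\<forall>k\<in>insert i I. young_function (f k)"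
    and [measurable]: "g \<in> borel_measurable borel" "h \<in> borel_measurable (Pi\<^sub>M (insert i I) (\<lambda>_. lborel))"
      "h \<in> borel_measurable (Pi\<^sub>M I (\<lambda>_. lborel))"
    and h: "\<And>x y. h (x(i := y)) = h x"
  shows "sublevel_integral f (insert i I) (\<lambda>x. g (x i) * h x) r
       = (\<integral>\<^sup>+y. g y * sublevel_integral f I h (r - f i \<bar>y\<bar>) \<partial>lborel)"
proof -
  interpret product_sigma_finite "\<lambda>_::'a. lborel :: real measure" by standard
  have [measurable]: "Measurable.pred (Pi\<^sub>M (insert i I) (\<lambda>_. lborel)) (\<lambda>x. x \<in> sublevel f (insert i I) r)"
    unfolding pred_def by (rule sublevel_measurable[OF f])
  have [measurable]: "Measurable.pred (Pi\<^sub>M I (\<lambda>_. lborel)) (\<lambda>x. x \<in> sublevel f I s)" for s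
    unfolding pred_def by (rule sublevel_measurable) (use f in auto)
  have "sublevel_integral f (insert i I) (\<lambda>x. g (x i) * h x) r
     = (\<integral>\<^sup>+y. (\<integral>\<^sup>+x. g ((x(i := y)) i) * h (x(i := y)) * indicator (sublevel f (insert i I) r) (x(i := y))
          \<partial>Pi\<^sub>M I (\<lambda>_. lborel)) \<partial>lborel)"
    unfolding sublevel_integral_def by (rule product_nn_integral_insert_rev[OF I]) measurable
  also have "\<dots> = (\<integral>\<^sup>+y. g y * sublevel_integral f I h (r - f i \<bar>y\<bar>) \<partial>lborel)"
  proof (rule nn_integral_cong)
    fix y
    have "(\<Sum>k\<in>insert i I. f k \<bar>(x(i := y)) k\<bar>) = f i \<bar>y\<bar> + (\<Sum>k\<in>I. f k \<bar>x k\<bar>)" for x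
      using I by (auto intro!: sum.cong)
    then have "indicator (sublevel f (insert i I) r) (x(i := y)) = (indicator (sublevel f I (r - f i \<bar>y\<bar>)) x :: ennreal)" for x
      by (auto simp: sublevel_def indicator_def)
    then have "(\<integral>\<^sup>+x. g ((x(i := y)) i) * h (x(i := y)) * indicator (sublevel f (insert i I) r) (x(i := y))
          \<partial>Pi\<^sub>M I (\<lambda>_. lborel)) = (\<integral>\<^sup>+x. g y * (h x * indicator (sublevel f I (r - f i \<bar>y\<bar>)) x) \<partial>Pi\<^sub>M I (\<lambda>_. lborel))"
      by (simp add: h mult.assoc)
    also have "\<dots> = g y * sublevel_integral f I h (r - f i \<bar>y\<bar>)"
      unfolding sublevel_integral_def by (rule nn_integral_cmult) measurable
    finally show "(\<integral>\<^sup>+x. g ((x(i := y)) i) * h (x(i := y)) * indicator (sublevel f (insert i I) r) (x(i := y))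
          \<partial>Pi\<^sub>M I (\<lambda>_. lborel)) = g y * sublevel_integral f I h (r - f i \<bar>y\<bar>)" .
  qed
  finally show ?thesis .
qed

lemma sublevel_integral_insert_coordinate:
  assumes I: "finite I" "i \<notin> I" and f: "\<forall>k\<in>insert i I. young_function (f k)"
    and g: "g \<in> borel_measurable borel"
  shows "sublevel_integral f (insert i I) (\<lambda>x. g (x i)) r
       = (\<integral>\<^sup>+y. g y * sublevel_integral f I (\<lambda>_. 1) (r - f i \<bar>y\<bar>) \<partial>lborel)"
proof -
  have "sublevel_integral f (insert i I) (\<lambda>x. g (x i) * 1) r
      = (\<integral>\<^sup>+y. g y * sublevel_integral f I (\<lambda>_. 1) (r - f i \<bar>y\<bar>) \<partial>lborel)"
    by (rule sublevel_integral_insert[OF I f g]) auto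
  then show ?thesis by (simp only: mult_1_right)
qed

lemma sublevel_integral_mono: "r \<le> s \<Longrightarrow> sublevel_integral f I h r \<le> sublevel_integral f I h s"
  unfolding sublevel_integral_def
  by (intro nn_integral_mono mult_left_mono) (auto simp: sublevel_def indicator_def)

lemma sublevel_integral_neg:
  assumes "\<forall>i\<in>I. young_function (f i)" "r < 0"
  shows "sublevel_integral f I h r = 0"
proof -
  have "x \<notin> sublevel f I r" for x
  proof -
    have "0 \<le> (\<Sum>i\<in>I. f i \<bar>x i\<bar>)"
      using assms(1) by (intro sum_nonneg) (simp add: young_nonneg)
    then show ?thesis using assms(2) by (simp add: sublevel_def)
  qed
  then show ?thesis by (simp add: sublevel_integral_def)
qed

lemma sublevel_integral_empty:
  "sublevel_integral f {} h r = (if 0 \<le> r then h (\<lambda>_. undefined) else 0)"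
  unfolding sublevel_integral_def PiM_empty
  by (subst nn_integral_count_space_finite) (auto simp: sublevel_def)

lemma sublevel_integral_finite:
  assumes "finite I" "\<forall>i\<in>I. young_function (f i)"
  shows "sublevel_integral f I (\<lambda>_. 1) r < \<infinity>"
  using assms
proof (induction I arbitrary: r rule: finite_induct)
  case empty
  show ?case by (simp add: sublevel_integral_empty)
next
  case (insert i I)
  have fi: "young_function (f i)" and fI: "\<forall>k\<in>I. young_function (f k)"
    using insert.prems by simp_all
  from young_coercive[OF fi, of r] obtain R where R: "0 < R" "\<forall>x. R < \<bar>x\<bar> \<longrightarrow> r < f i \<bar>x\<bar>"
    by (elim exE conjE)
  have "sublevel_integral f (insert i I) (\<lambda>_. 1) r = (\<integral>\<^sup>+y. sublevel_integral f I (\<lambda>_. 1) (r - f i \<bar>y\<bar>) \<partial>lborel)"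
    using sublevel_integral_insert_coordinate[OF insert.hyps(1,2) insert.prems, of "\<lambda>_. 1" r]
    by (simp only: mult_1_left borel_measurable_const)
  also have "\<dots> \<le> (\<integral>\<^sup>+y. sublevel_integral f I (\<lambda>_. 1) r * indicator {-R..R} y \<partial>lborel)"
  proof (rule nn_integral_mono)
    fix y
    show "sublevel_integral f I (\<lambda>_. 1) (r - f i \<bar>y\<bar>) \<le> sublevel_integral f I (\<lambda>_. 1) r * indicator {-R..R} y"
    proof (cases "R < \<bar>y\<bar>")
      case True
      then show ?thesis using R(2) sublevel_integral_neg[of I f "r - f i \<bar>y\<bar>"] fI by simp
    next
      case False
      then have "y \<in> {-R..R}" by auto
      then show ?thesis using young_nonneg[OF fi, of "\<bar>y\<bar>"] by (simp add: sublevel_integral_mono)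
    qed
  qed
  also have "\<dots> = sublevel_integral f I (\<lambda>_. 1) r * ennreal (2 * R)"
    using R(1) by (subst nn_integral_cmult_indicator) auto
  also have "\<dots> < \<infinity>" using insert.IH[OF fI] by (simp add: ennreal_mult_less_top)
  finally show ?case .
qed

lemma ennreal_sublevel_volume:
  assumes "finite I" "\<forall>i\<in>I. young_function (f i)"
  shows "ennreal (sublevel_volume f I r) = sublevel_integral f I (\<lambda>_. 1) r"
  unfolding sublevel_volume_def using sublevel_integral_finite[OF assms] by simp

lemma sublevel_volume_nonneg: "0 \<le> sublevel_volume f I r"
  by (simp add: sublevel_volume_def)

lemma sublevel_volume_mono:
  assumes "finite I" "\<forall>i\<in>I. young_function (f i)" "r \<le> s"
  shows "sublevel_volume f I r \<le> sublevel_volume f I s"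
  unfolding sublevel_volume_def using sublevel_integral_finite[OF assms(1,2)]
  by (intro enn2real_mono sublevel_integral_mono assms) auto

lemma sublevel_volume_neg:
  assumes "\<forall>i\<in>I. young_function (f i)" "r < 0"
  shows "sublevel_volume f I r = 0"
  by (simp add: sublevel_volume_def sublevel_integral_neg[OF assms])

text \<open>Up to normalisation, this function of \<open>y\<close> is the marginal density of a coordinate with Young
  function \<open>\<phi>\<close>.\<close>

lemma section_volume_radially_decreasing:
  assumes "finite I" "\<forall>k\<in>I. young_function (f k)" "young_function \<phi>"
  shows "radially_decreasing (\<lambda>y. sublevel_volume f I (r - \<phi> \<bar>y\<bar>))"
  unfolding radially_decreasing_def
  using young_abs_mono[OF assms(3)]
  by (intro allI impI sublevel_volume_mono assms(1,2)) simp

lemma section_volume_bounded_support: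
  assumes "\<forall>k\<in>I. young_function (f k)" "young_function \<phi>"
  shows "bounded_support (\<lambda>y. sublevel_volume f I (r - \<phi> \<bar>y\<bar>))"
  using young_coercive[OF assms(2), of r] unfolding bounded_support_def
  by (force intro!: sublevel_volume_neg assms(1))

lemma section_volume_integrable:
  assumes "finite I" "\<forall>k\<in>I. young_function (f k)" "young_function \<phi>"
  shows "integrable lborel (\<lambda>y. y ^ n * sublevel_volume f I (r - \<phi> \<bar>y\<bar>))"
  by (intro radially_decreasing_power_integrable sublevel_volume_nonneg
        section_volume_radially_decreasing section_volume_bounded_support assms)

lemma sublevel_integral_power:
  assumes I: "finite I" "i \<notin> I" and f: "\<forall>k\<in>insert i I. young_function (f k)"
    and n: "even n"
  shows "sublevel_integral f (insert i I) (\<lambda>x. ennreal (x i ^ n)) r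
       = ennreal (\<integral>y. y ^ n * sublevel_volume f I (r - f i \<bar>y\<bar>) \<partial>lborel)"
proof -
  have "sublevel_integral f (insert i I) (\<lambda>x. ennreal (x i ^ n)) r
      = (\<integral>\<^sup>+y. ennreal (y ^ n) * sublevel_integral f I (\<lambda>_. 1) (r - f i \<bar>y\<bar>) \<partial>lborel)"
    by (rule sublevel_integral_insert_coordinate[OF I f]) measurable
  also have "\<dots> = (\<integral>\<^sup>+y. ennreal (y ^ n * sublevel_volume f I (r - f i \<bar>y\<bar>)) \<partial>lborel)"
    using n f I(1) by (simp add: ennreal_mult sublevel_volume_nonneg zero_le_even_power ennreal_sublevel_volume)
  also have "\<dots> = ennreal (\<integral>y. y ^ n * sublevel_volume f I (r - f i \<bar>y\<bar>) \<partial>lborel)"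
    using n f I(1)
    by (intro nn_integral_eq_integral section_volume_integrable AE_I2)
       (auto simp: sublevel_volume_nonneg zero_le_even_power)
  finally show ?thesis .
qed

lemma sublevel_volume_insert:
  assumes I: "finite I" "i \<notin> I" and f: "\<forall>k\<in>insert i I. young_function (f k)"
  shows "sublevel_volume f (insert i I) r = (\<integral>y. sublevel_volume f I (r - f i \<bar>y\<bar>) \<partial>lborel)"
  using sublevel_integral_power[OF I f, of 0 r]
  by (simp add: sublevel_volume_def[of f "insert i I"] integral_nonneg_AE sublevel_volume_nonneg)

text \<open>Joint log-concavity in the level and in the fixed coordinate: the remaining level is a concave
  function of both, and \<open>V\<close> is nondecreasing.\<close>

lemma log_concave_section:
  assumes V: "log_concave V" "mono V" and f: "young_function \<phi>"
    and t: "0 \<le> t" "t \<le> 1"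
  shows "V (r - \<phi> \<bar>x\<bar>) powr (1 - t) * V (s - \<phi> \<bar>y\<bar>) powr t
       \<le> V (((1 - t) * r + t * s) - \<phi> \<bar>(1 - t) * x + t * y\<bar>)"
proof -
  have "V (r - \<phi> \<bar>x\<bar>) powr (1 - t) * V (s - \<phi> \<bar>y\<bar>) powr t
      \<le> V ((1 - t) * (r - \<phi> \<bar>x\<bar>) + t * (s - \<phi> \<bar>y\<bar>))"
    by (rule log_concaveD[OF V(1) t])
  also have "\<dots> \<le> V (((1 - t) * r + t * s) - \<phi> \<bar>(1 - t) * x + t * y\<bar>)"
    using young_abs_convex[OF f t, of x y] by (intro monoD[OF V(2)]) (simp add: algebra_simps)
  finally show ?thesis .
qed

text \<open>The Prekopa--Leindler inequality says that integrating a coordinate out of a jointly log-concave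
  function leaves a log-concave function; this is the induction step.\<close>

lemma sublevel_volume_log_concave:
  assumes "finite I" "\<forall>i\<in>I. young_function (f i)"
  shows "log_concave (sublevel_volume f I)"
  using assms
proof (induction I rule: finite_induct)
  case empty
  have "sublevel_volume f {} r = (if 0 \<le> r then 1 else 0)" for r
    by (simp add: sublevel_volume_def sublevel_integral_empty)
  then show ?case
    by (auto simp: log_concave_def not_le add_nonneg_nonneg mult_nonneg_nonneg)
next
  case (insert i I)
  have V: "log_concave (sublevel_volume f I)" "mono (sublevel_volume f I)"
    using insert by (auto intro!: monoI sublevel_volume_mono)
  show ?case
    unfolding log_concave_def
  proof (intro conjI allI impI)
    fix r s t :: real assume t: "0 \<le> t" "t \<le> 1"
    show "sublevel_volume f (insert i I) r powr (1 - t) * sublevel_volume f (insert i I) s powr t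
        \<le> sublevel_volume f (insert i I) ((1 - t) * r + t * s)"
      unfolding sublevel_volume_insert[OF insert.hyps(1,2) insert.prems]
      using insert.prems insert.hyps(1)
      by (intro prekopa_leindler_radial log_concave_section V t sublevel_volume_nonneg
            section_volume_radially_decreasing section_volume_bounded_support) auto
  qed (rule sublevel_volume_nonneg)
qed

lemma sublevel_fourth_moment:
  assumes I: "finite I" "i \<notin> I" and f: "\<forall>k\<in>insert i I. young_function (f k)"
  shows "(\<integral>y. y ^ 4 * sublevel_volume f I (r - f i \<bar>y\<bar>) \<partial>lborel) * sublevel_volume f (insert i I) r
       \<le> 6 * (\<integral>y. y\<^sup>2 * sublevel_volume f I (r - f i \<bar>y\<bar>) \<partial>lborel)\<^sup>2"
proof -
  have V: "log_concave (sublevel_volume f I)" "mono (sublevel_volume f I)"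
    using f I by (auto intro!: monoI sublevel_volume_mono sublevel_volume_log_concave)
  have "log_concave (\<lambda>y. sublevel_volume f I (r - f i \<bar>y\<bar>))"
    unfolding log_concave_def
  proof (intro conjI allI impI)
    fix x y t :: real assume t: "0 \<le> t" "t \<le> 1"
    have "(1 - t) * r + t * r = r" by (simp add: algebra_simps)
    then show "sublevel_volume f I (r - f i \<bar>x\<bar>) powr (1 - t) * sublevel_volume f I (r - f i \<bar>y\<bar>) powr t
        \<le> sublevel_volume f I (r - f i \<bar>(1 - t) * x + t * y\<bar>)"
      using log_concave_section[OF V _ t, of "f i" r x r y] f by simp
  qed (rule sublevel_volume_nonneg)
  then show ?thesis
    unfolding sublevel_volume_insert[OF I f]
    using f I by (intro log_concave_radial_fourth_moment section_volume_radially_decreasing section_volume_bounded_support) auto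
qed

text \<open>The joint density of coordinates \<open>i\<close> and \<open>j\<close> is the volume of the remaining coordinates at level
  \<open>r - f i \<bar>x\<bar> - f j \<bar>y\<bar>\<close>. Passing from \<open>x\<close> to \<open>x'\<close> lowers this level by the same amount for every
  \<open>y\<close>, so the four levels that belong to \<open>x, x'\<close> and \<open>y, y'\<close> have equal sums along both diagonals
  and log-concavity of the volume gives the sign condition.\<close>

lemma sublevel_negative_correlation:
  assumes J: "finite J" "j \<notin> J" and i: "i \<notin> insert j J"
    and f: "\<forall>k\<in>insert i (insert j J). young_function (f k)"
  shows "sublevel_integral f (insert i (insert j J)) (\<lambda>x. ennreal ((x i)\<^sup>2 * (x j)\<^sup>2)) r
          * sublevel_integral f (insert i (insert j J)) (\<lambda>_. 1) r
       \<le> sublevel_integral f (insert i (insert j J)) (\<lambda>x. ennreal ((x i)\<^sup>2)) r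
          * sublevel_integral f (insert i (insert j J)) (\<lambda>x. ennreal ((x j)\<^sup>2)) r"
proof -
  define W where "W x y = sublevel_volume f J (r - f i \<bar>x\<bar> - f j \<bar>y\<bar>)" for x y
  have fs: "young_function (f i)" "young_function (f j)" and fJ: "\<forall>k\<in>J. young_function (f k)"
    and fjJ: "\<forall>k\<in>insert j J. young_function (f k)"
    using f by auto
  obtain R1 where R1: "R1 > 0" "\<And>x. R1 < \<bar>x\<bar> \<Longrightarrow> r < f i \<bar>x\<bar>" using young_coercive[OF fs(1), of r] by blast
  obtain R2 where R2: "R2 > 0" "\<And>x. R2 < \<bar>x\<bar> \<Longrightarrow> r < f j \<bar>x\<bar>" using young_coercive[OF fs(2), of r] by blast
  have W0: "0 \<le> W x y" for x y by (simp add: W_def sublevel_volume_nonneg)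
  have WR: "W x y = 0" if "max R1 R2 < \<bar>x\<bar> \<or> max R1 R2 < \<bar>y\<bar>" for x y
    unfolding W_def
    using that R1(2)[of x] R2(2)[of y] young_nonneg[OF fs(1), of "\<bar>x\<bar>"] young_nonneg[OF fs(2), of "\<bar>y\<bar>"]
    by (intro sublevel_volume_neg fJ) auto
  have dec: "radially_decreasing (W x)" "radially_decreasing (\<lambda>x. W x y)" for x y
  proof -
    show "radially_decreasing (W x)"
      unfolding W_def by (intro section_volume_radially_decreasing J fJ fs)
    have "radially_decreasing (\<lambda>x. sublevel_volume f J ((r - f j \<bar>y\<bar>) - f i \<bar>x\<bar>))"
      by (intro section_volume_radially_decreasing J fJ fs)
    then show "radially_decreasing (\<lambda>x. W x y)" by (simp add: W_def algebra_simps)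
  qed
  have neg: "(\<integral>x. x\<^sup>2 * (\<integral>y. y\<^sup>2 * W x y \<partial>lborel) \<partial>lborel) * (\<integral>x. (\<integral>y. W x y \<partial>lborel) \<partial>lborel)
       \<le> (\<integral>x. x\<^sup>2 * (\<integral>y. W x y \<partial>lborel) \<partial>lborel) * (\<integral>x. (\<integral>y. y\<^sup>2 * W x y \<partial>lborel) \<partial>lborel)"
  proof (rule reverse_rule_negative_correlation[where R = "max R1 R2"])
    fix x x' y y' :: real assume "\<bar>x\<bar> \<le> \<bar>x'\<bar>" "\<bar>y\<bar> \<le> \<bar>y'\<bar>"
    then have "f i \<bar>x\<bar> \<le> f i \<bar>x'\<bar>" "f j \<bar>y\<bar> \<le> f j \<bar>y'\<bar>" using fs by (simp_all add: young_abs_mono)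
    then have "W x' y' * W x y \<le> W x y' * W x' y"
      unfolding W_def by (intro log_concave_four_points sublevel_volume_log_concave J fJ) auto
    then show "W x y * W x' y' \<le> W x y' * W x' y" by (simp add: mult.commute)
  qed (use W0 WR dec R1 in auto)
  have moment: "sublevel_integral f (insert i (insert j J)) (\<lambda>x. ennreal (x i ^ m) * ennreal (x j ^ n)) r
      = ennreal (\<integral>x. x ^ m * (\<integral>y. y ^ n * W x y \<partial>lborel) \<partial>lborel)" if mn: "even m" "even n" for m n
  proof -
    have inner0: "0 \<le> (\<integral>y. y ^ n * W x y \<partial>lborel)" for x
      using W0 mn by (intro integral_nonneg_AE AE_I2) (auto simp: zero_le_even_power)
    have intW: "integrable lborel (\<lambda>y. y ^ n * W x y)" for x
      unfolding W_def by (intro section_volume_integrable J fJ fs)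
    have "sublevel_integral f (insert i (insert j J)) (\<lambda>x. ennreal (x i ^ m) * ennreal (x j ^ n)) r
       = (\<integral>\<^sup>+x. ennreal (x ^ m) * sublevel_integral f (insert j J) (\<lambda>z. ennreal (z j ^ n)) (r - f i \<bar>x\<bar>) \<partial>lborel)"
      by (rule sublevel_integral_insert) (use i J f in auto)
    also have "\<dots> = (\<integral>\<^sup>+x. ennreal (x ^ m * (\<integral>y. y ^ n * W x y \<partial>lborel)) \<partial>lborel)"
      using mn inner0 by (simp add: sublevel_integral_power[OF J fjJ mn(2)] W_def[symmetric] ennreal_mult zero_le_even_power)
    also have "\<dots> = ennreal (\<integral>x. x ^ m * (\<integral>y. y ^ n * W x y \<partial>lborel) \<partial>lborel)"
    proof (rule nn_integral_eq_integral)
      show "integrable lborel (\<lambda>x. x ^ m * (\<integral>y. y ^ n * W x y \<partial>lborel))"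
      proof (intro radially_decreasing_power_integrable inner0)
        show "radially_decreasing (\<lambda>x. \<integral>y. y ^ n * W x y \<partial>lborel)"
          unfolding radially_decreasing_def using dec(2) mn
          by (intro allI impI integral_mono intW mult_left_mono)
             (auto simp: radially_decreasing_def zero_le_even_power)
        show "bounded_support (\<lambda>x. \<integral>y. y ^ n * W x y \<partial>lborel)"
          unfolding bounded_support_def using WR R1 by (intro exI[of _ "max R1 R2"]) auto
      qed
    qed (use mn inner0 in \<open>auto simp: zero_le_even_power\<close>)
    finally show ?thesis .
  qed
  have nn: "0 \<le> (\<integral>x. x ^ m * (\<integral>y. y ^ n * W x y \<partial>lborel) \<partial>lborel)" if "even m" "even n" for m n
    using W0 that by (intro integral_nonneg_AE AE_I2 mult_nonneg_nonneg) (auto simp: zero_le_even_power)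
  show ?thesis
    using moment[of 2 2] moment[of 2 0] moment[of 0 2] moment[of 0 0] neg
      nn[of 2 2] nn[of 2 0] nn[of 0 2] nn[of 0 0]
    by (simp add: ennreal_mult[symmetric] ennreal_leI)
qed

section \<open>Moments of an isotropic Orlicz ball\<close>

lemma vec_lambda_borel_measurable:
  "(\<lambda>z. (\<chi> i. z i) :: real ^ 'n::finite) \<in> borel_measurable (Pi\<^sub>M UNIV (\<lambda>_. lborel))"
proof (subst borel_measurable_euclidean_space, rule ballI)
  fix b :: "real ^ 'n" assume "b \<in> Basis"
  then obtain k where b: "b = axis k 1" by (auto simp: Basis_vec_def)
  have "(\<lambda>z. z k) \<in> borel_measurable (Pi\<^sub>M UNIV (\<lambda>_::'n. lborel :: real measure))" by measurable
  then show "(\<lambda>z. (\<chi> i. z i) \<bullet> b) \<in> borel_measurable (Pi\<^sub>M UNIV (\<lambda>_. lborel))"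
    by (simp add: b inner_axis)
qed

lemma lborel_vec_eq_distr_PiM:
  "(lborel :: (real ^ 'n::finite) measure) = distr (Pi\<^sub>M UNIV (\<lambda>_. lborel)) borel (\<lambda>z. \<chi> i. z i)"
proof (rule lborel_eqI)
  interpret product_sigma_finite "\<lambda>_::'n. lborel :: real measure" by standard
  note [measurable] = vec_lambda_borel_measurable
  fix l u :: "real ^ 'n" assume "\<And>b. b \<in> Basis \<Longrightarrow> l \<bullet> b \<le> u \<bullet> b"
  then have lu: "l $ i \<le> u $ i" for i
    using axis_in_Basis_iff[of i "1::real"] by (force simp: cart_eq_inner_axis)
  have "(\<lambda>z. (\<chi> i. z i) :: real ^ 'n) -` box l u \<inter> space (Pi\<^sub>M UNIV (\<lambda>_. lborel)) = Pi\<^sub>E UNIV (\<lambda>i. {l $ i <..< u $ i})"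
    by (auto simp: mem_box Basis_vec_def inner_axis space_PiM PiE_def Pi_def)
  then have "emeasure (distr (Pi\<^sub>M UNIV (\<lambda>_. lborel)) borel (\<lambda>z. \<chi> i. z i)) (box l u)
      = (\<Prod>i\<in>UNIV. emeasure lborel {l $ i <..< u $ i})"
    by (simp add: emeasure_distr emeasure_PiM)
  also have "\<dots> = ennreal (\<Prod>i\<in>UNIV. u $ i - l $ i)"
    using lu by (simp add: prod_ennreal)
  also have "(\<Prod>i\<in>UNIV. u $ i - l $ i) = (\<Prod>b\<in>Basis. (u - l) \<bullet> b)"
  proof -
    have inj: "inj (\<lambda>i::'n. axis i (1::real))" by (auto simp: inj_on_def axis_eq_axis)
    have Basis: "(Basis :: (real ^ 'n) set) = range (\<lambda>i. axis i 1)" by (auto simp: Basis_vec_def)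
    show ?thesis unfolding Basis prod.reindex[OF inj] by (simp add: inner_axis)
  qed
  finally show "emeasure (distr (Pi\<^sub>M UNIV (\<lambda>_. lborel)) borel (\<lambda>z. \<chi> i. z i)) (box l u)
      = ennreal (\<Prod>b\<in>Basis. (u - l) \<bullet> b)" .
qed simp

lemma nn_integral_uniform_orlicz_ball:
  fixes f :: "'n::finite \<Rightarrow> real \<Rightarrow> real"
  assumes K: "emeasure lborel (orlicz_ball f) = 1"
    and [measurable]: "h \<in> borel_measurable borel"
  shows "(\<integral>\<^sup>+x. h x \<partial>uniform_on (orlicz_ball f)) = sublevel_integral f UNIV (\<lambda>z. h (\<chi> i. z i)) 1"
proof -
  have [measurable]: "orlicz_ball f \<in> sets borel"
    using K emeasure_notin_sets[of "orlicz_ball f" lborel] by force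
  note [measurable] = vec_lambda_borel_measurable
  have "(\<integral>\<^sup>+x. h x \<partial>uniform_on (orlicz_ball f)) = (\<integral>\<^sup>+x. h x * indicator (orlicz_ball f) x \<partial>lborel)"
    by (subst nn_integral_uniform_measure) (auto simp: K divide_ennreal_def)
  also have "\<dots> = (\<integral>\<^sup>+z. h (\<chi> i. z i) * indicator (orlicz_ball f) (\<chi> i. z i) \<partial>Pi\<^sub>M UNIV (\<lambda>_. lborel))"
    by (subst lborel_vec_eq_distr_PiM, subst nn_integral_distr) measurable
  also have "\<dots> = sublevel_integral f UNIV (\<lambda>z. h (\<chi> i. z i)) 1"
    unfolding sublevel_integral_def
    by (intro nn_integral_cong) (simp add: orlicz_ball_def sublevel_def indicator_def)
  finally show ?thesis .
qed

text \<open>Off the diagonal this is negative correlation of the squares, on the diagonal the fourth moment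
  bound for the marginal density; in both cases the volume is 1 and the second moments are \<open>L\<^sup>2\<close>.\<close>

lemma isotropic_orlicz_ball_moments:
  fixes f :: "'n::finite \<Rightarrow> real \<Rightarrow> real"
  assumes f: "\<forall>i. young_function (f i)"
    and K: "emeasure lborel (orlicz_ball f) = 1" and L: "isotropic_with L (orlicz_ball f)"
  shows "(\<integral>\<^sup>+x. ennreal ((x $ i)\<^sup>2 * (x $ j)\<^sup>2) \<partial>uniform_on (orlicz_ball f))
       \<le> ennreal ((if i = j then 6 else 1) * L ^ 4)"
proof -
  have L0: "0 < L" and eq: "(\<integral>x. (x $ i)\<^sup>2 \<partial>uniform_on (orlicz_ball f)) = L\<^sup>2" for i
    using L by (auto simp: isotropic_with_def power2_eq_square[of "_ $ _"])
  have second: "sublevel_integral f UNIV (\<lambda>z. ennreal ((z i)\<^sup>2)) 1 = ennreal (L\<^sup>2)" for i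
  proof -
    have "integrable (uniform_on (orlicz_ball f)) (\<lambda>x. (x $ i)\<^sup>2)"
      using eq[of i] L0 not_integrable_integral_eq by fastforce
    then have "(\<integral>\<^sup>+x. ennreal ((x $ i)\<^sup>2) \<partial>uniform_on (orlicz_ball f)) = ennreal (L\<^sup>2)"
      using eq[of i] by (subst nn_integral_eq_integral) auto
    then show ?thesis by (subst (asm) nn_integral_uniform_orlicz_ball[OF K]) auto
  qed
  have total: "sublevel_integral f UNIV (\<lambda>_. 1) 1 = 1"
  proof -
    have "emeasure (uniform_on (orlicz_ball f)) (space (uniform_on (orlicz_ball f))) = 1"
      using K by (intro prob_space.emeasure_space_1 prob_space_uniform_measure) auto
    then have "(\<integral>\<^sup>+x. 1 \<partial>uniform_on (orlicz_ball f)) = 1" by simp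
    then show ?thesis by (subst (asm) nn_integral_uniform_orlicz_ball[OF K]) auto
  qed
  have mom: "(\<integral>\<^sup>+x. ennreal ((x $ i)\<^sup>2 * (x $ j)\<^sup>2) \<partial>uniform_on (orlicz_ball f))
      = sublevel_integral f UNIV (\<lambda>z. ennreal ((z i)\<^sup>2 * (z j)\<^sup>2)) 1"
    by (subst nn_integral_uniform_orlicz_ball[OF K]) auto
  show ?thesis
  proof (cases "i = j")
    case False
    define J where "J = UNIV - {i, j}"
    have UJ: "insert i (insert j J) = UNIV" by (auto simp: J_def)
    have "sublevel_integral f UNIV (\<lambda>z. ennreal ((z i)\<^sup>2 * (z j)\<^sup>2)) 1 * 1 \<le> ennreal (L\<^sup>2) * ennreal (L\<^sup>2)"
      using sublevel_negative_correlation[of J j i f 1] f False unfolding UJ second total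
      by (auto simp: J_def)
    also have "\<dots> = ennreal (L ^ 4)"
      by (simp add: ennreal_mult[symmetric] power4_eq_xxxx power2_eq_square mult.assoc)
    finally show ?thesis using False by (simp add: mom)
  next
    case True
    define I where "I = UNIV - {i}"
    have UI: "insert i I = UNIV" and I: "finite I" "i \<notin> I" by (auto simp: I_def)
    have fI: "\<forall>k\<in>insert i I. young_function (f k)" using f by simp
    define m where "m n = (\<integral>y. y ^ n * sublevel_volume f I (1 - f i \<bar>y\<bar>) \<partial>lborel)" for n :: nat
    have m: "sublevel_integral f UNIV (\<lambda>z. ennreal (z i ^ n)) 1 = ennreal (m n)" "0 \<le> m n" if "even n" for n
    proof -
      show "sublevel_integral f UNIV (\<lambda>z. ennreal (z i ^ n)) 1 = ennreal (m n)"
        using sublevel_integral_power[OF I fI that, of 1] by (simp add: UI m_def)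
      show "0 \<le> m n"
        unfolding m_def using that
        by (intro integral_nonneg_AE AE_I2 mult_nonneg_nonneg sublevel_volume_nonneg) (simp add: zero_le_even_power)
    qed
    have m2: "m 2 = L\<^sup>2" using m[of 2] second[of i] L0 by simp
    have "sublevel_volume f UNIV 1 = 1" by (simp add: sublevel_volume_def total)
    then have "m 4 \<le> 6 * (L\<^sup>2)\<^sup>2"
      using sublevel_fourth_moment[OF I fI, of 1] by (simp add: UI m_def[symmetric] m2)
    then have "m 4 \<le> 6 * L ^ 4" by simp
    moreover have "(z i)\<^sup>2 * (z i)\<^sup>2 = z i ^ 4" for z :: "'n \<Rightarrow> real"
      by (simp add: power4_eq_xxxx power2_eq_square)
    ultimately show ?thesis using m(1)[of 4] 
      unfolding mom unfolding True[symmetric] by (simp add: ennreal_leI)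
  qed
qed

text \<open>The off-diagonal covariances are nonpositive, so that only the diagonal ones count.\<close>

lemma variance_sum_le:
  fixes X :: "'n::finite \<Rightarrow> 'a \<Rightarrow> real"
  assumes M: "prob_space M" and X: "\<And>i. integrable M (X i)" "\<And>i. (\<integral>x. X i x \<partial>M) = m"
    and XX: "\<And>i j. integrable M (\<lambda>x. X i x * X j x)"
    and le: "\<And>i j. (\<integral>x. X i x * X j x \<partial>M) \<le> m\<^sup>2 + (if i = j then c else 0)"
  shows "prob_space.variance M (\<lambda>x. \<Sum>i\<in>UNIV. X i x) \<le> real CARD('n) * c"
proof -
  interpret prob_space M by fact
  have sq: "(\<Sum>i\<in>UNIV. X i x)\<^sup>2 = (\<Sum>i\<in>UNIV. \<Sum>j\<in>UNIV. X i x * X j x)" for x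
    by (simp add: power2_eq_square sum_product)
  have "variance (\<lambda>x. \<Sum>i\<in>UNIV. X i x)
      = (\<Sum>i\<in>UNIV. \<Sum>j\<in>UNIV. expectation (\<lambda>x. X i x * X j x)) - (real CARD('n) * m)\<^sup>2"
    using X XX by (subst variance_eq) (auto simp: sq)
  also have "(\<Sum>i\<in>UNIV. \<Sum>j\<in>UNIV. expectation (\<lambda>x. X i x * X j x))
      \<le> (\<Sum>i\<in>(UNIV::'n set). \<Sum>j\<in>(UNIV::'n set). m\<^sup>2 + (if i = j then c else 0))"
    by (intro sum_mono le)
  also have "\<dots> = (real CARD('n) * m)\<^sup>2 + real CARD('n) * c"
    by (simp add: sum.distrib power2_eq_square algebra_simps)
  finally show ?thesis by simp
qed

theorem theorem4p1:
  fixes K :: "(real ^ 'n::finite) set"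
  assumes "generalized_orlicz_ball K"
    and "isotropic K"
  shows "sigma_K K \<le> sqrt 5"
proof -
  obtain f where f: "\<forall>i. young_function (f i)" and Kf: "K = orlicz_ball f"
    using assms(1) by (auto simp: generalized_orlicz_ball_def)
  obtain L where K: "emeasure lborel K = 1" and L: "isotropic_with L K"
    using assms(2) by (auto simp: isotropic_def)
  have L0: "0 < L" and eq: "(\<integral>x. (x $ i)\<^sup>2 \<partial>uniform_on K) = L\<^sup>2" for i
    using L by (auto simp: isotropic_with_def power2_eq_square[of "_ $ _"])
  have int: "integrable (uniform_on K) (\<lambda>x. (x $ i)\<^sup>2)" for i
    using eq[of i] L0 not_integrable_integral_eq by fastforce
  have mom: "(\<integral>\<^sup>+x. ennreal ((x $ i)\<^sup>2 * (x $ j)\<^sup>2) \<partial>uniform_on K) \<le> ennreal ((if i = j then 6 else 1) * L ^ 4)" for i j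
    using isotropic_orlicz_ball_moments[OF f] K L by (simp add: Kf)
  have int2: "integrable (uniform_on K) (\<lambda>x. (x $ i)\<^sup>2 * (x $ j)\<^sup>2)" for i j
    using le_less_trans[OF mom[of i j] ennreal_less_top] by (intro integrableI_nonneg) auto
  have le: "(\<integral>x. (x $ i)\<^sup>2 * (x $ j)\<^sup>2 \<partial>uniform_on K) \<le> (L\<^sup>2)\<^sup>2 + (if i = j then 5 * L ^ 4 else 0)" for i j
  proof -
    have "ennreal (\<integral>x. (x $ i)\<^sup>2 * (x $ j)\<^sup>2 \<partial>uniform_on K) \<le> ennreal ((if i = j then 6 else 1) * L ^ 4)"
      using mom[of i j] by (subst (asm) nn_integral_eq_integral[OF int2]) auto
    then show ?thesis using L0 by (subst (asm) ennreal_le_iff) (auto split: if_splits)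
  qed
  have "prob_space (uniform_on K)" using K by (intro prob_space_uniform_measure) auto
  from variance_sum_le[OF this int eq int2 le]
  have "prob_space.variance (uniform_on K) (\<lambda>x. (norm x)\<^sup>2) \<le> real CARD('n) * (5 * L ^ 4)"
    by (simp add: power2_norm_eq_inner inner_vec_def power2_eq_square[of "_ $ _"])
  then show ?thesis
    using L0 by (simp add: sigma_K_def isotropic_constant_eq[OF L] field_simps)
qed

end
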